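(* Assume the multicolor Erdős–Hajnal conjecture: for all integers $k,m\ge 2$ and every coloring $\chi$ of $E(K_k)$ with $m$ colors, there exists $\varepsilon>0$ such that every coloring of the edges of $K_n$ with these $m$ colors contains either $k$ vertices whose edges are colored according to $\chi$ (i.e. a copy of $\chi$) or a set of $n^\varepsilon$ vertices whose edges use at most $m-1$ colors. Then for every grid subgraph $H$ such that no two horizontal edges of $H$ join the same two columns, $H\in\mathbf{PGR}$, i.e. there is a constant $C_H$ with $\operatorname{gr}(H,K_k)\le k^{C_H}$ for all $k\ge 2$.
   Context: A grid subgraph on $c$ columns and $r$ rows is a graph whose vertex set is a subset of $[c]\times[r]$ (vertex $(x,y)$ lies in column $x$, row $y$) and whose edges each join two vertices in the same row (horizontal edge) or the same column (vertical edge). A horizontal edge $\{(x,y),(x',y)\}$ is said to be between columns $x$ and $x'$. $G_{N\times N}=K_N\square K_N$; a spanning grid subgraph is a spanning subgraph of it. An embedding of $H$ (on $c_H$ columns, $r_H$ rows) into $G$ is a pair of injections $\varphi_c:[c_H]\to[c_G]$, $\varphi_r:[r_H]\to[r_G]$ sending each edge $\{(x,y),(x',y')\}$ of $H$ to an edge $\{(\varphi_c(x),\varphi_r(y)),(\varphi_c(x'),\varphi_r(y'))\}$ of $G$; $G$ contains $H$ if one exists. A coclique of size $k$ is a set of $k$ pairwise non-adjacent vertices all in one row or all in one column. $\operatorname{gr}(H,K_k)$ is the least $N$ such that every spanning grid subgraph of $G_{N\times N}$ contains $H$ or a coclique of size $k$. $\mathbf{PGR}$ is the class of grid subgraphs $H$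 with $\operatorname{gr}(H,K_k)=k^{O_H(1)}$. *)

theory Defs
  imports Complex_Main "HOL-Library.FuncSet" "HOL-Library.Extended_Nat" "HOL-Library.Ramsey"
begin

text \<open>The pair \<open>(x, y)\<close> is the point in column \<open>x\<close> and row \<open>y\<close>; edges are two-element sets of points.\<close>

record grid_graph =
  cols :: nat
  rows :: nat
  verts :: "(nat \<times> nat) set"
  edges :: "(nat \<times> nat) set set"

definition grid_subgraph :: "grid_graph \<Rightarrow> bool" where
  "grid_subgraph H \<longleftrightarrow>
     verts H \<subseteq> {1..cols H} \<times> {1..rows H} \<and>
     (\<forall>e\<in>edges H. \<exists>x y x' y'. e = {(x, y), (x', y')} \<and>
        (x, y) \<in> verts H \<and> (x', y') \<in> verts H \<and> (x, y) \<noteq> (x', y') \<and> (x = x' \<or> y = y'))"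

definition horizontal_edge_between :: "grid_graph \<Rightarrow> (nat \<times> nat) set \<Rightarrow> nat \<Rightarrow> nat \<Rightarrow> bool" where
  "horizontal_edge_between H e x x' \<longleftrightarrow>
     e \<in> edges H \<and> x \<noteq> x' \<and> (\<exists>y. e = {(x, y), (x', y)})"

definition complete_grid :: "nat \<Rightarrow> grid_graph" where
  "complete_grid N =
     \<lparr> cols = N, rows = N, verts = {1..N} \<times> {1..N},
       edges = {{(x, y), (x', y')} | x y x' y'.
         x \<in> {1..N} \<and> y \<in> {1..N} \<and> x' \<in> {1..N} \<and> y' \<in> {1..N} \<and>
         (x, y) \<noteq> (x', y') \<and> (x = x' \<or> y = y')} \<rparr>"

definition spanning_grid_subgraph :: "nat \<Rightarrow> grid_graph \<Rightarrow> bool" where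
  "spanning_grid_subgraph N G \<longleftrightarrow>
     cols G = N \<and> rows G = N \<and>
     verts G = verts (complete_grid N) \<and> edges G \<subseteq> edges (complete_grid N)"

definition grid_embedding ::
    "grid_graph \<Rightarrow> grid_graph \<Rightarrow> (nat \<Rightarrow> nat) \<Rightarrow> (nat \<Rightarrow> nat) \<Rightarrow> bool" where
  "grid_embedding H G \<phi>\<^sub>c \<phi>\<^sub>r \<longleftrightarrow>
     \<phi>\<^sub>c \<in> {1..cols H} \<rightarrow> {1..cols G} \<and> inj_on \<phi>\<^sub>c {1..cols H} \<and>
     \<phi>\<^sub>r \<in> {1..rows H} \<rightarrow> {1..rows G} \<and> inj_on \<phi>\<^sub>r {1..rows H} \<and>
     (\<forall>x y x' y'. {(x, y), (x', y')} \<in> edges H \<longrightarrow>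
        {(\<phi>\<^sub>c x, \<phi>\<^sub>r y), (\<phi>\<^sub>c x', \<phi>\<^sub>r y')} \<in> edges G)"

definition grid_contains :: "grid_graph \<Rightarrow> grid_graph \<Rightarrow> bool" where
  "grid_contains G H \<longleftrightarrow> (\<exists>\<phi>\<^sub>c \<phi>\<^sub>r. grid_embedding H G \<phi>\<^sub>c \<phi>\<^sub>r)"

definition grid_coclique :: "grid_graph \<Rightarrow> nat \<Rightarrow> (nat \<times> nat) set \<Rightarrow> bool" where
  "grid_coclique G k S \<longleftrightarrow>
     S \<subseteq> verts G \<and> finite S \<and> card S = k \<and>
     pairwise (\<lambda>u v. {u, v} \<notin> edges G) S \<and>
     ((\<exists>y. \<forall>v\<in>S. snd v = y) \<or> (\<exists>x. \<forall>v\<in>S. fst v = x))"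

text \<open>The infimum is taken in \<open>enat\<close>, so that it is \<open>\<infinity>\<close>, rather than an unspecified number,
  if no \<open>N\<close> qualifies. In particular any finite bound on it includes the existence of such an \<open>N\<close>.\<close>

definition gr :: "grid_graph \<Rightarrow> nat \<Rightarrow> enat" where
  "gr H k = Inf (enat ` {N. \<forall>G. spanning_grid_subgraph N G \<longrightarrow>
     grid_contains G H \<or> (\<exists>S. grid_coclique G k S)})"

definition PGR :: "grid_graph set" where
  "PGR = {H. grid_subgraph H \<and> (\<exists>C::nat. \<forall>k\<ge>2. gr H k \<le> enat (k ^ C))}"

text \<open>A colouring of the edges of \<open>K\<^sub>n\<close> with \<open>m\<close> colours need not use all the colours.\<close>

definition edge_colouring :: "nat \<Rightarrow> nat \<Rightarrow> (nat set \<Rightarrow> nat) \<Rightarrow> bool" where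
  "edge_colouring n m c \<longleftrightarrow> c \<in> nsets {1..n} 2 \<rightarrow> {1..m}"

definition contains_colour_copy ::
    "nat \<Rightarrow> (nat set \<Rightarrow> nat) \<Rightarrow> nat \<Rightarrow> (nat set \<Rightarrow> nat) \<Rightarrow> bool" where
  "contains_colour_copy n c k \<chi> \<longleftrightarrow>
     (\<exists>f. f \<in> {1..k} \<rightarrow> {1..n} \<and> inj_on f {1..k} \<and> (\<forall>e\<in>nsets {1..k} 2. c (f ` e) = \<chi> e))"

definition multicolour_erdos_hajnal :: bool where
  "multicolour_erdos_hajnal \<longleftrightarrow>
     (\<forall>k\<ge>2. \<forall>m\<ge>2. \<forall>\<chi>. edge_colouring k m \<chi> \<longrightarrow>
       (\<exists>\<epsilon>>0::real. \<forall>n c. edge_colouring n m c \<longrightarrow>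
          contains_colour_copy n c k \<chi> \<or>
          (\<exists>S\<subseteq>{1..n}. real (card S) \<ge> real n powr \<epsilon> \<and> card (c ` nsets S 2) \<le> m - 1)))"

end

theory Submission
  imports Defs
begin

text \<open>By Ramsey and pigeonhole, a grid without a coclique of size \<open>k\<close> has many columns in which
  the same \<open>R\<close> rows form a vertical clique. Colour a pair of these columns by the \<^emph>\<open>set\<close> of those rows
  in which it is joined. As long as every row occurs in some colour, the pattern of horizontal edges
  of \<open>H\<close> can be realised by a colouring with the available colours, because a pair of columns of \<open>H\<close>
  needs only one row. So Erdos-Hajnal gives a copy of \<open>H\<close> or a polynomially large set of columns
  with fewer colours. Iterating, either \<open>H\<close> is found or some row occurs in no colour, and then the
  remaining columns form a coclique in that row.\<close>

section \<open>A polynomial Ramsey bound\<close>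

text \<open>For fixed \<open>s\<close> the bound is polynomial in \<open>k\<close>. Take an
  inclusion-maximal coclique \<open>J\<close>. If it has fewer than \<open>k\<close> vertices, these
  and their neighbourhoods cover \<open>V\<close>, so some \<open>v\<close> in \<open>J\<close> has
  at least \<open>k ^ s\<close> neighbours. A clique of size \<open>s\<close> inside that
  neighbourhood extends by \<open>v\<close>.\<close>

lemma clique_or_coclique_power:
  fixes k s :: nat and V :: "'a set" and E :: "'a set set"
  assumes "finite V" "k ^ s \<le> card V" "1 \<le> k"
  shows "(\<exists>K\<subseteq>V. card K = s \<and> pairwise (\<lambda>u v. {u, v} \<in> E) K) \<or>
         (\<exists>S\<subseteq>V. card S = k \<and> pairwise (\<lambda>u v. {u, v} \<notin> E) S)"
  using assms
proof (induction s arbitrary: V)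
  case 0
  show ?case by (intro disjI1 exI[of _ "{}"]) auto
next
  case (Suc s)
  define indep where "indep S \<longleftrightarrow> S \<subseteq> V \<and> pairwise (\<lambda>u v. {u, v} \<notin> E) S" for S
  define N where "N v = {u \<in> V. u \<noteq> v \<and> {v, u} \<in> E}" for v
  have "indep {}" by (simp add: indep_def)
  moreover have "finite {S. indep S}"
    using \<open>finite V\<close> by (auto simp: indep_def intro: finite_subset[of _ "Pow V"])
  ultimately obtain J where J: "indep J" and J_max: "\<And>S. indep S \<Longrightarrow> J \<subseteq> S \<Longrightarrow> J = S"
    using finite_has_maximal[of "{S. indep S}"] by blast
  have finJ: "finite J" and JV: "J \<subseteq> V"
    using J \<open>finite V\<close> by (auto simp: indep_def intro: finite_subset)
  show ?case
  proof (cases "k \<le> card J")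
    case True
    then obtain S where "S \<subseteq> J" "card S = k"
      by (meson obtain_subset_with_card_n)
    moreover have "pairwise (\<lambda>u v. {u, v} \<notin> E) S" "S \<subseteq> V"
      using J \<open>S \<subseteq> J\<close> unfolding indep_def by (blast intro: pairwise_subset)+
    ultimately show ?thesis by blast
  next
    case False
    have cover: "V \<subseteq> (\<Union>v\<in>J. insert v (N v))"
    proof
      fix u assume u: "u \<in> V"
      show "u \<in> (\<Union>v\<in>J. insert v (N v))"
      proof (rule ccontr)
        assume *: "u \<notin> (\<Union>v\<in>J. insert v (N v))"
        then have "indep (insert u J)"
          using J u by (auto simp: indep_def N_def pairwise_insert insert_commute)
        with J_max[of "insert u J"] * show False by auto
      qed
    qed
    have "\<exists>v\<in>J. k ^ s \<le> card (N v)"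
    proof (rule ccontr)
      assume "\<not> ?thesis"
      \<comment> \<open>The strict bound on \<open>card (N v)\<close> leaves room for
        \<open>v\<close> itself.\<close>
      then have small: "card (insert v (N v)) \<le> k ^ s" if "v \<in> J" for v
        using that \<open>finite V\<close> by (force simp: N_def)
      have "card V \<le> card (\<Union>v\<in>J. insert v (N v))"
        using finJ \<open>finite V\<close> cover by (intro card_mono) (auto simp: N_def)
      also have "\<dots> \<le> (\<Sum>v\<in>J. card (insert v (N v)))"
        by (rule card_UN_le[OF finJ])
      also have "\<dots> \<le> card J * k ^ s"
        using sum_bounded_above[of J "\<lambda>v. card (insert v (N v))" "k ^ s"] small by simp
      also have "\<dots> < k * k ^ s"
        using False \<open>1 \<le> k\<close> by simp
      finally show False using Suc.prems by simp
    qed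
    then obtain v where v: "v \<in> J" "k ^ s \<le> card (N v)" by blast
    have NV: "N v \<subseteq> V" and "finite (N v)" using \<open>finite V\<close> by (auto simp: N_def)
    from Suc.IH[OF \<open>finite (N v)\<close> v(2) \<open>1 \<le> k\<close>] show ?thesis
    proof
      assume "\<exists>K\<subseteq>N v. card K = s \<and> pairwise (\<lambda>u v. {u, v} \<in> E) K"
      then obtain K where K: "K \<subseteq> N v" "card K = s" "pairwise (\<lambda>u v. {u, v} \<in> E) K" by blast
      have "card (insert v K) = Suc s"
        using K \<open>finite (N v)\<close> by (subst card_insert_disjoint) (auto simp: N_def intro: finite_subset)
      moreover have "pairwise (\<lambda>u v. {u, v} \<in> E) (insert v K)"
        using K by (auto simp: pairwise_insert N_def insert_commute)
      moreover have "insert v K \<subseteq> V" using K NV JV v by auto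
      ultimately show ?thesis by blast
    qed (use NV in blast)
  qed
qed

section \<open>The multicolour Erdos-Hajnal property\<close>

text \<open>Replaces the real exponent by a natural one: if \<open>D\<close> is at least
  \<open>1 / \<epsilon>\<close>, then \<open>n\<close> at least \<open>k ^ D\<close> makes
  \<open>n powr \<epsilon>\<close> at least \<open>k\<close>.\<close>

lemma multicolour_erdos_hajnal_single:
  assumes EH: "multicolour_erdos_hajnal" and "2 \<le> p" "2 \<le> m" "edge_colouring p m \<chi>"
  obtains D :: nat where
    "\<And>n c k. edge_colouring n m c \<Longrightarrow> 1 \<le> k \<Longrightarrow> k ^ D \<le> n \<Longrightarrow>
       contains_colour_copy n c p \<chi> \<or>
       (\<exists>S\<subseteq>{1..n}. k \<le> card S \<and> card (c ` nsets S 2) \<le> m - 1)"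
proof -
  obtain \<epsilon> :: real where "\<epsilon> > 0" and \<epsilon>: "\<And>n c. edge_colouring n m c \<Longrightarrow>
     contains_colour_copy n c p \<chi> \<or>
     (\<exists>S\<subseteq>{1..n}. real (card S) \<ge> real n powr \<epsilon> \<and> card (c ` nsets S 2) \<le> m - 1)"
    using EH[unfolded multicolour_erdos_hajnal_def, rule_format, OF assms(2-4)] by blast
  define D where "D = nat \<lceil>1 / \<epsilon>\<rceil>"
  have D: "1 \<le> real D * \<epsilon>"
  proof -
    have "1 / \<epsilon> \<le> real D" unfolding D_def by linarith
    then show ?thesis using \<open>\<epsilon> > 0\<close> by (simp add: field_simps)
  qed
  have large: "real k \<le> real n powr \<epsilon>" if "1 \<le> k" "k ^ D \<le> n" for k n :: nat
  proof -
    have "real k = real k powr 1" using that by simp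
    also have "\<dots> \<le> real k powr (real D * \<epsilon>)"
      using that D by (intro powr_mono) auto
    also have "\<dots> = real (k ^ D) powr \<epsilon>"
      using that by (simp add: powr_powr [symmetric] powr_realpow)
    also have "\<dots> \<le> real n powr \<epsilon>"
      using that \<open>\<epsilon> > 0\<close> by (intro powr_mono2) (auto simp flip: of_nat_power)
    finally show ?thesis .
  qed
  show thesis
  proof (rule that)
    fix n c k assume "edge_colouring n m c" "1 \<le> k" "k ^ D \<le> n"
    with \<epsilon>[of n c] large[of k n] show "contains_colour_copy n c p \<chi> \<or>
       (\<exists>S\<subseteq>{1..n}. k \<le> card S \<and> card (c ` nsets S 2) \<le> m - 1)"
      by (meson of_nat_le_iff order_trans)
  qed
qed

text \<open>Only the values of \<open>\<chi>\<close> on pairs from \<open>{1..p}\<close> matter,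
  which leaves finitely many patterns, so the maximum of their exponents serves all of them. The
  later induction relies on this: it must fix the exponent before the colours, and hence the
  pattern, are known.\<close>

lemma multicolour_erdos_hajnal_uniform:
  assumes EH: "multicolour_erdos_hajnal" and "2 \<le> p" "2 \<le> m"
  obtains D :: nat where
    "\<And>\<chi> n c k. edge_colouring p m \<chi> \<Longrightarrow> edge_colouring n m c \<Longrightarrow> 1 \<le> k \<Longrightarrow> k ^ D \<le> n \<Longrightarrow>
       contains_colour_copy n c p \<chi> \<or>
       (\<exists>S\<subseteq>{1..n}. k \<le> card S \<and> card (c ` nsets S 2) \<le> m - 1)"
proof -
  define good where "good \<chi> D \<longleftrightarrow> (\<forall>n c k. edge_colouring n m c \<longrightarrow> 1 \<le> k \<longrightarrow> k ^ D \<le> n \<longrightarrow>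
       contains_colour_copy n c p \<chi> \<or>
       (\<exists>S\<subseteq>{1..n}. k \<le> card S \<and> card (c ` nsets S 2) \<le> m - 1))" for \<chi> D
  \<comment> \<open>Extensional functions make the set of patterns finite; an arbitrary
    \<open>\<chi>\<close> is brought into it by \<open>restrict\<close>.\<close>
  define X where "X = (nsets {1..p} 2 \<rightarrow>\<^sub>E {1..m})"
  have finX: "finite X" unfolding X_def by (intro finite_PiE) (auto simp: finite_imp_finite_nsets)
  have "\<exists>D. good \<chi> D" if "\<chi> \<in> X" for \<chi>
  proof -
    have "edge_colouring p m \<chi>" using that by (auto simp: edge_colouring_def X_def)
    from multicolour_erdos_hajnal_single[OF assms this] show ?thesis
      unfolding good_def by metis
  qed
  then obtain d where d: "\<And>\<chi>. \<chi> \<in> X \<Longrightarrow> good \<chi> (d \<chi>)" by metis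
  show thesis
  proof (rule that)
    fix \<chi> n c k
    assume \<chi>: "edge_colouring p m \<chi>" and c: "edge_colouring n m c" "1 \<le> k"
      and le: "k ^ Max (insert 0 (d ` X)) \<le> n"
    let ?\<chi> = "restrict \<chi> (nsets {1..p} 2)"
    have X: "?\<chi> \<in> X" using \<chi> by (auto simp: X_def edge_colouring_def)
    have "d ?\<chi> \<le> Max (insert 0 (d ` X))" using X finX by (intro Max_ge) auto
    then have "k ^ d ?\<chi> \<le> n" using le power_increasing[OF _ \<open>1 \<le> k\<close>] order_trans by blast
    then have "contains_colour_copy n c p ?\<chi> \<or>
       (\<exists>S\<subseteq>{1..n}. k \<le> card S \<and> card (c ` nsets S 2) \<le> m - 1)"
      using d[OF X] c unfolding good_def by blast
    moreover have "contains_colour_copy n c p ?\<chi> = contains_colour_copy n c p \<chi>"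
      unfolding contains_colour_copy_def by simp
    ultimately show "contains_colour_copy n c p \<chi> \<or>
       (\<exists>S\<subseteq>{1..n}. k \<le> card S \<and> card (c ` nsets S 2) \<le> m - 1)" by simp
  qed
qed

lemma image_in_nsets:
  assumes "f \<in> A \<rightarrow> B" "inj_on f A" "e \<in> nsets A r"
  shows "f ` e \<in> nsets B r"
  using assms by (auto simp: nsets_def card_image inj_on_subset)

text \<open>Relabelling along bijections with initial segments allows any finite vertex set and any
  \<open>m\<close>-element set of colours. In the application the vertices are columns and the
  colours are sets of rows.\<close>

lemma multicolour_erdos_hajnal_finite_sets:
  fixes p m :: nat
  assumes EH: "multicolour_erdos_hajnal" and "2 \<le> p" "2 \<le> m"
  obtains D :: nat where
    "\<And>(V :: 'a set) (F :: 'b set) g \<chi> k. finite V \<Longrightarrow> finite F \<Longrightarrow> card F = m \<Longrightarrow>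
       g \<in> nsets V 2 \<rightarrow> F \<Longrightarrow> \<chi> \<in> nsets {1..p} 2 \<rightarrow> F \<Longrightarrow> 1 \<le> k \<Longrightarrow> k ^ D \<le> card V \<Longrightarrow>
       (\<exists>f \<in> {1..p} \<rightarrow> V. inj_on f {1..p} \<and> (\<forall>e\<in>nsets {1..p} 2. g (f ` e) = \<chi> e)) \<or>
       (\<exists>S\<subseteq>V. k \<le> card S \<and> card (g ` nsets S 2) \<le> m - 1)"
proof -
  obtain D :: nat where D: "\<And>\<chi> n c k. edge_colouring p m \<chi> \<Longrightarrow> edge_colouring n m c \<Longrightarrow>
       1 \<le> k \<Longrightarrow> k ^ D \<le> n \<Longrightarrow> contains_colour_copy n c p \<chi> \<or>
       (\<exists>S\<subseteq>{1..n}. k \<le> card S \<and> card (c ` nsets S 2) \<le> m - 1)"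
    using multicolour_erdos_hajnal_uniform[OF assms] by blast
  show thesis
  proof (rule that)
    fix V :: "'a set" and F :: "'b set" and g \<chi> and k :: nat
    assume fin: "finite V" "finite F" and m: "card F = m" and g: "g \<in> nsets V 2 \<rightarrow> F"
      and \<chi>: "\<chi> \<in> nsets {1..p} 2 \<rightarrow> F" and k: "1 \<le> k" "k ^ D \<le> card V"
    obtain h where h: "bij_betw h {1..card V} V"
      using ex_bij_betw_nat_finite_1[OF fin(1)] by blast
    obtain l where l: "bij_betw l F {1..m}"
      using ex_bij_betw_finite_nat[OF fin(2)] m
      by (metis fin(2) finite_atLeastAtMost finite_same_card_bij card_atLeastAtMost diff_Suc_1)
    have hF: "h \<in> {1..card V} \<rightarrow> V" "inj_on h {1..card V}"
      using h by (auto simp: bij_betw_def)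
    have lF: "l \<in> F \<rightarrow> {1..m}" "inj_on l F"
      using l by (auto simp: bij_betw_def)
    define c where "c e = l (g (h ` e))" for e
    have gh: "g (h ` e) \<in> F" if "e \<in> nsets {1..card V} 2" for e
      using image_in_nsets[OF hF that] g by blast
    have "edge_colouring (card V) m c"
      unfolding edge_colouring_def c_def using gh lF by blast
    moreover have "edge_colouring p m (l \<circ> \<chi>)"
      unfolding edge_colouring_def using \<chi> lF by auto
    ultimately consider
        "contains_colour_copy (card V) c p (l \<circ> \<chi>)"
      | S where "S \<subseteq> {1..card V}" "k \<le> card S" "card (c ` nsets S 2) \<le> m - 1"
      using D k by blast
    then show "(\<exists>f \<in> {1..p} \<rightarrow> V. inj_on f {1..p} \<and> (\<forall>e\<in>nsets {1..p} 2. g (f ` e) = \<chi> e)) \<or>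
       (\<exists>S\<subseteq>V. k \<le> card S \<and> card (g ` nsets S 2) \<le> m - 1)"
    proof cases
      case 1
      then obtain f where f: "f \<in> {1..p} \<rightarrow> {1..card V}" "inj_on f {1..p}"
        and fc: "\<And>e. e \<in> nsets {1..p} 2 \<Longrightarrow> c (f ` e) = l (\<chi> e)"
        unfolding contains_colour_copy_def by auto
      have "h \<circ> f \<in> {1..p} \<rightarrow> V" using f hF by auto
      moreover have "inj_on (h \<circ> f) {1..p}"
        using f hF by (intro comp_inj_on) (auto intro: inj_on_subset)
      moreover have "g ((h \<circ> f) ` e) = \<chi> e" if e: "e \<in> nsets {1..p} 2" for e
      proof -
        have "l (g (h ` f ` e)) = l (\<chi> e)" using fc[OF e] by (simp add: c_def)
        then have "g (h ` f ` e) = \<chi> e"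
          using gh[OF image_in_nsets[OF f e]] \<chi> e lF(2) by (blast dest: inj_onD)
        then show ?thesis by (simp add: image_comp)
      qed
      ultimately show ?thesis by blast
    next
      case (2 S)
      have inj: "inj_on h S" using 2 hF by (blast intro: inj_on_subset)
      have hSV: "h ` S \<subseteq> V" using 2 hF by blast
      have sub: "g ` nsets (h ` S) 2 \<subseteq> F"
        using g nsets_mono[OF hSV, of 2] by blast
      \<comment> \<open>As \<open>l\<close> is injective on \<open>F\<close>, this inclusion shows
        that \<open>g\<close> uses no more colours on the image of \<open>S\<close> than
        \<open>c\<close> uses on \<open>S\<close>.\<close>
      have "l ` g ` nsets (h ` S) 2 \<subseteq> c ` nsets S 2"
      proof clarify
        fix e assume "e \<in> nsets (h ` S) 2"
        then obtain e' where e': "e' \<subseteq> S" "e = h ` e'"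
          by (auto simp: nsets_def subset_image_iff)
        then have "e' \<in> nsets S 2"
          using \<open>e \<in> _\<close> inj by (auto simp: nsets_def card_image inj_on_subset finite_image_iff)
        then show "l (g e) \<in> c ` nsets S 2" using e' by (auto simp: c_def)
      qed
      moreover have "finite (c ` nsets S 2)"
        using 2 by (intro finite_imageI finite_imp_finite_nsets) (auto intro: finite_subset)
      moreover have "card (l ` g ` nsets (h ` S) 2) = card (g ` nsets (h ` S) 2)"
        using sub lF(2) by (intro card_image) (rule inj_on_subset)
      ultimately have "card (g ` nsets (h ` S) 2) \<le> m - 1"
        using 2 card_mono by (metis order_trans)
      moreover have "k \<le> card (h ` S)" using 2 inj by (simp add: card_image)
      ultimately show ?thesis using hSV by blast
    qed
  qed
qed

text \<open>Colours are sets of labels, and a copy of the pattern only has to have the wanted label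
  in the colour of each pair. The induction is on the bound \<open>m\<close> for the number of
  colours: a step either finishes or passes to a large set of vertices that sees fewer colours.
  \<open>D\<close> is chosen before \<open>V\<close>, \<open>F\<close>, \<open>g\<close> and
  \<open>k\<close>.\<close>

lemma pattern_or_uncovered:
  fixes I :: "'i set" and \<chi> :: "nat set \<Rightarrow> 'i"
  assumes EH: "multicolour_erdos_hajnal" and "2 \<le> p" and \<chi>: "\<chi> \<in> nsets {1..p} 2 \<rightarrow> I"
  shows "\<exists>D\<ge>1. \<forall>(V :: 'a set) F g k. finite V \<longrightarrow> finite F \<longrightarrow> card F \<le> m \<longrightarrow>
       g \<in> nsets V 2 \<rightarrow> F \<longrightarrow> 2 \<le> k \<longrightarrow> k ^ D \<le> card V \<longrightarrow>
       (\<exists>f \<in> {1..p} \<rightarrow> V. inj_on f {1..p} \<and> (\<forall>e\<in>nsets {1..p} 2. \<chi> e \<in> g (f ` e))) \<or>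
       (\<exists>i\<in>I. \<exists>S\<subseteq>V. k \<le> card S \<and> (\<forall>e\<in>nsets S 2. i \<notin> g e))"
    (is "\<exists>D\<ge>1. ?P m D")
proof (induction m)
  case 0
  \<comment> \<open>Without colours there can be no pair of vertices, but \<open>V\<close> has at
    least \<open>k\<close>, hence two, elements.\<close>
  have "?P 0 1"
  proof (intro allI impI)
    fix V :: "'a set" and F :: "'i set set" and g and k :: nat
    assume A: "finite V" "finite F" "card F \<le> 0" "g \<in> nsets V 2 \<rightarrow> F" "2 \<le> k" "k ^ 1 \<le> card V"
    then have "2 \<le> card V" by simp
    then obtain e where "e \<subseteq> V" "card e = 2" "finite e" by (meson obtain_subset_with_card_n)
    then have "e \<in> nsets V 2" by (simp add: nsets_def)
    with A have False by auto
    then show "(\<exists>f \<in> {1..p} \<rightarrow> V. inj_on f {1..p} \<and> (\<forall>e\<in>nsets {1..p} 2. \<chi> e \<in> g (f ` e))) \<or>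
       (\<exists>i\<in>I. \<exists>S\<subseteq>V. k \<le> card S \<and> (\<forall>e\<in>nsets S 2. i \<notin> g e))" ..
  qed
  then show ?case by (intro exI[of _ 1]) blast
next
  case (Suc m)
  then obtain D where "D \<ge> 1" and D: "?P m D" by blast
  \<comment> \<open>The conjecture speaks of at least two colours. Keeping
    \<open>2 \<le> Suc m\<close> as a premise yields a \<open>D'\<close> for every \<open>m\<close>;
    a single colour is treated separately.\<close>
  obtain D' :: nat where D': "2 \<le> Suc m \<Longrightarrow> finite V \<Longrightarrow> finite F \<Longrightarrow> card F = Suc m \<Longrightarrow>
       g \<in> nsets V 2 \<rightarrow> F \<Longrightarrow> \<chi>' \<in> nsets {1..p} 2 \<rightarrow> F \<Longrightarrow> 1 \<le> k \<Longrightarrow> k ^ D' \<le> card V \<Longrightarrow>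
       (\<exists>f \<in> {1..p} \<rightarrow> V. inj_on f {1..p} \<and> (\<forall>e\<in>nsets {1..p} 2. g (f ` e) = \<chi>' e)) \<or>
       (\<exists>S\<subseteq>V. k \<le> card S \<and> card (g ` nsets S 2) \<le> Suc m - 1)"
    for V :: "'a set" and F :: "'i set set" and g \<chi>' and k :: nat
  proof (cases "2 \<le> Suc m")
    case True
    show thesis
      by (rule multicolour_erdos_hajnal_finite_sets[OF EH \<open>2 \<le> p\<close> True]) (rule that)
  qed (use that in blast)
  \<comment> \<open>The exponent dominates all that are required: \<open>D\<close> for the induction
    hypothesis, \<open>D * D'\<close> for Erdos-Hajnal with \<open>k ^ D\<close> in place of
    \<open>k\<close>, and \<open>p\<close> so that \<open>V\<close> has at least \<open>p\<close>
    elements.\<close>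
  have "?P (Suc m) (D * Suc D' + p)"
  proof (intro allI impI)
    fix V :: "'a set" and F :: "'i set set" and g and k :: nat
    assume fin: "finite V" "finite F" and F: "card F \<le> Suc m" and g: "g \<in> nsets V 2 \<rightarrow> F"
      and k: "2 \<le> k" and kV: "k ^ (D * Suc D' + p) \<le> card V"
    have le: "k ^ j \<le> card V" if "j \<le> D * Suc D' + p" for j
      using power_increasing[OF that, of k] k kV by linarith
    have kV1: "k \<le> card V" using le[of 1] \<open>2 \<le> p\<close> by simp
    have "p < k ^ p" using k by (intro power_gt_expt) simp
    then have pV: "p \<le> card V" using le[of p] by simp
    show "(\<exists>f \<in> {1..p} \<rightarrow> V. inj_on f {1..p} \<and> (\<forall>e\<in>nsets {1..p} 2. \<chi> e \<in> g (f ` e))) \<or>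
       (\<exists>i\<in>I. \<exists>S\<subseteq>V. k \<le> card S \<and> (\<forall>e\<in>nsets S 2. i \<notin> g e))" (is "?copy \<or> ?unc")
    proof (cases "I \<subseteq> \<Union>F")
      case False
      then obtain i where "i \<in> I" "i \<notin> \<Union>F" by blast
      then show ?thesis using g kV1 by blast
    next
      case cov: True
      consider "card F \<le> m" | "card F = Suc m" "m = 0" | "card F = Suc m" "2 \<le> Suc m"
        using F by linarith
      then show ?thesis
      proof cases
        case 1
        have "k ^ D \<le> card V" by (rule le) simp
        then show ?thesis using D fin 1 g k by blast
      next
        case 2
        \<comment> \<open>The only colour \<open>A\<close> contains every label, because the colours
          cover \<open>I\<close>. Hence any \<open>p\<close> vertices carry the pattern.\<close>
        then obtain A where A: "F = {A}" by (metis One_nat_def card_1_singletonE)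
        obtain U where U: "U \<subseteq> V" "card U = p" "finite U" using pV by (meson obtain_subset_with_card_n)
        obtain f where f: "bij_betw f {1..p} U"
          using ex_bij_betw_nat_finite_1[OF \<open>finite U\<close>] U by blast
        have f': "f \<in> {1..p} \<rightarrow> V" "inj_on f {1..p}"
          using f U by (auto simp: bij_betw_def)
        have "\<chi> e \<in> g (f ` e)" if e: "e \<in> nsets {1..p} 2" for e
          using image_in_nsets[OF f' e] g A cov \<chi> e by blast
        then show ?thesis using f' by blast
      next
        case 3
        \<comment> \<open>Choosing for each label a colour that contains it turns the pattern of
          labels \<open>\<chi>\<close> into the genuine colour pattern
          \<open>A \<circ> \<chi>\<close>.\<close>
        have "\<forall>i\<in>I. \<exists>B. B \<in> F \<and> i \<in> B" using cov by blast
        from bchoice[OF this] obtain A where A: "\<And>i. i \<in> I \<Longrightarrow> A i \<in> F \<and> i \<in> A i" by blast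
        have "A \<circ> \<chi> \<in> nsets {1..p} 2 \<rightarrow> F" using A \<chi> by (simp add: Pi_iff)
        moreover have "(k ^ D) ^ D' \<le> card V"
          unfolding power_mult[symmetric] by (rule le) simp
        ultimately consider
            f where "f \<in> {1..p} \<rightarrow> V" "inj_on f {1..p}" "\<forall>e\<in>nsets {1..p} 2. g (f ` e) = A (\<chi> e)"
          | S where "S \<subseteq> V" "k ^ D \<le> card S" "card (g ` nsets S 2) \<le> m"
          using D'[OF 3(2) fin 3(1) g, of "A \<circ> \<chi>" "k ^ D"] k
          unfolding comp_apply diff_Suc_1 by fastforce
        then show ?thesis
        proof cases
          case (1 f)
          then have "\<forall>e\<in>nsets {1..p} 2. \<chi> e \<in> g (f ` e)" using A \<chi> by (simp add: Pi_iff)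
          then show ?thesis using 1 by blast
        next
          case (2 S)
          have "finite S" using 2 fin by (blast intro: finite_subset)
          moreover have "finite (g ` nsets S 2)"
            using \<open>finite S\<close> by (simp add: finite_imp_finite_nsets)
          moreover have "g \<in> nsets S 2 \<rightarrow> g ` nsets S 2" by blast
          \<comment> \<open>The induction hypothesis is applied to \<open>S\<close> with the colours
            that actually occur there, at most \<open>m\<close> of them.\<close>
          ultimately have "(\<exists>f \<in> {1..p} \<rightarrow> S. inj_on f {1..p} \<and> (\<forall>e\<in>nsets {1..p} 2. \<chi> e \<in> g (f ` e))) \<or>
             (\<exists>i\<in>I. \<exists>T\<subseteq>S. k \<le> card T \<and> (\<forall>e\<in>nsets T 2. i \<notin> g e))"
            using D[rule_format, of S "g ` nsets S 2" g k] 2 k by blast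
          then consider
              f where "f \<in> {1..p} \<rightarrow> S" "inj_on f {1..p}" "\<forall>e\<in>nsets {1..p} 2. \<chi> e \<in> g (f ` e)"
            | i T where "i \<in> I" "T \<subseteq> S" "k \<le> card T" "\<forall>e\<in>nsets T 2. i \<notin> g e"
            by blast
          then show ?thesis
          proof cases
            case (1 f)
            then show ?thesis using 2 by blast
          next
            case (2 i T)
            then show ?thesis using \<open>S \<subseteq> V\<close> by blast
          qed
        qed
      qed
    qed
  qed
  moreover have "D * Suc D' + p \<ge> 1" using \<open>2 \<le> p\<close> by simp
  ultimately show ?case by blast
qed

section \<open>Grids\<close>

text \<open>Each column already has a vertical clique of size \<open>R\<close> among its first
  \<open>k ^ R\<close> rows. Restricting to these rows leaves at most \<open>k ^ (R * R)\<close>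
  possible cliques, independently of \<open>N\<close>, so by pigeonhole one of them is shared by
  \<open>k ^ D\<close> columns.\<close>

lemma many_columns_same_clique:
  fixes N k R D :: nat
  assumes "1 \<le> k" and "1 \<le> R" and N: "k ^ (R * R + D) \<le> N"
    and no_coclique: "\<And>x S. x \<in> {1..N} \<Longrightarrow> S \<subseteq> {1..N} \<Longrightarrow> card S = k \<Longrightarrow>
      \<not> pairwise (\<lambda>y y'. {(x, y), (x, y')} \<notin> E) S"
  obtains K V where "K \<subseteq> {1..N}" "card K = R" "V \<subseteq> {1..N}" "k ^ D \<le> card V"
    "\<And>x. x \<in> V \<Longrightarrow> pairwise (\<lambda>y y'. {(x, y), (x, y')} \<in> E) K"
proof -
  define Y where "Y = {1..k ^ R}"
  have "k ^ R \<le> k ^ (R * R + D)"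
    using \<open>1 \<le> k\<close> \<open>1 \<le> R\<close> by (intro power_increasing) (auto intro: trans_le_add1)
  then have YN: "Y \<subseteq> {1..N}" using N by (auto simp: Y_def)
  have "\<exists>K\<in>nsets Y R. pairwise (\<lambda>y y'. {(x, y), (x, y')} \<in> E) K" if x: "x \<in> {1..N}" for x
  proof -
    \<comment> \<open>Pulling \<open>E\<close> back along \<open>Pair x\<close> makes column
      \<open>x\<close> a graph on row indices.\<close>
    have inv: "{u, v} \<in> {e. Pair x ` e \<in> E} \<longleftrightarrow> {(x, u), (x, v)} \<in> E" for u v by simp
    have "(\<exists>K\<subseteq>Y. card K = R \<and> pairwise (\<lambda>y y'. {(x, y), (x, y')} \<in> E) K) \<or>
          (\<exists>S\<subseteq>Y. card S = k \<and> pairwise (\<lambda>y y'. {(x, y), (x, y')} \<notin> E) S)"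
      using clique_or_coclique_power[of Y k R "{e. Pair x ` e \<in> E}"] \<open>1 \<le> k\<close>
      unfolding inv by (simp add: Y_def)
    moreover have "\<not> (\<exists>S\<subseteq>Y. card S = k \<and> pairwise (\<lambda>y y'. {(x, y), (x, y')} \<notin> E) S)"
      using no_coclique[OF x] YN by blast
    ultimately obtain K where
      K: "K \<subseteq> Y" "card K = R" "pairwise (\<lambda>y y'. {(x, y), (x, y')} \<in> E) K"
      by blast
    then have "K \<in> nsets Y R" by (auto simp: nsets_def Y_def intro: finite_subset)
    then show ?thesis using K by blast
  qed
  then obtain q where q: "\<And>x. x \<in> {1..N} \<Longrightarrow> q x \<in> nsets Y R"
    "\<And>x. x \<in> {1..N} \<Longrightarrow> pairwise (\<lambda>y y'. {(x, y), (x, y')} \<in> E) (q x)"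
    by metis
  define fib where "fib K = {x \<in> {1..N}. q x = K}" for K
  have finQ: "finite (nsets Y R)" by (simp add: Y_def finite_imp_finite_nsets)
  have cardQ: "card (nsets Y R) \<le> k ^ (R * R)"
  proof -
    have "card (nsets Y R) = k ^ R choose R" by (simp add: Y_def)
    also have "\<dots> \<le> k ^ (R * R)"
      using binomial_le_pow[of R "k ^ R"] by (cases "R \<le> k ^ R") (simp_all add: power_mult binomial_eq_0)
    finally show ?thesis .
  qed
  have "\<exists>K\<in>nsets Y R. k ^ D \<le> card (fib K)"
  proof (rule ccontr)
    assume "\<not> ?thesis"
    then have small: "card (fib K) \<le> k ^ D - 1" if "K \<in> nsets Y R" for K
      using that by force
    have "{1..N} \<subseteq> (\<Union>K\<in>nsets Y R. fib K)" using q(1) by (auto simp: fib_def)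
    then have "card {1..N} \<le> card (\<Union>K\<in>nsets Y R. fib K)"
      using finQ by (intro card_mono) (auto simp: fib_def)
    also have "\<dots> \<le> (\<Sum>K\<in>nsets Y R. card (fib K))" by (rule card_UN_le[OF finQ])
    also have "\<dots> \<le> card (nsets Y R) * (k ^ D - 1)"
      using sum_bounded_above[of "nsets Y R" "\<lambda>K. card (fib K)" "k ^ D - 1"] small by simp
    also have "\<dots> \<le> k ^ (R * R) * (k ^ D - 1)" using cardQ by (rule mult_right_mono) simp
    also have "\<dots> < k ^ (R * R) * k ^ D" using \<open>1 \<le> k\<close> by simp
    finally show False using N by (simp add: power_add)
  qed
  then obtain K where K: "K \<in> nsets Y R" "k ^ D \<le> card (fib K)" by blast
  show thesis
  proof (rule that[of K "fib K"])
    show "K \<subseteq> {1..N}" "card K = R" using K YN by (auto simp: nsets_def)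
  qed (use K q(2) in \<open>auto simp: fib_def\<close>)
qed

theorem theorem1p5:
  fixes H :: grid_graph
  assumes "multicolour_erdos_hajnal"
    and "grid_subgraph H"
    and "\<And>e e' x x'. horizontal_edge_between H e x x' \<Longrightarrow> horizontal_edge_between H e' x x' \<Longrightarrow> e = e'"
  shows "H \<in> PGR"
proof -
  \<comment> \<open>Padding by two columns and one row ensures \<open>2 \<le> p\<close> and \<open>1 \<le> R\<close>.\<close>
  define p where "p = cols H + 2"
  define R where "R = rows H + 1"
  define joined where "joined e y \<longleftrightarrow> (\<lambda>x. (x, y)) ` e \<in> edges H" for e :: "nat set" and y
  \<comment> \<open>A pair of columns of \<open>H\<close> is labelled with the row of its horizontal
    edge. Pairs without one get the default row 1: this may force an extra edge in the copy, which
    is harmless because an embedding need not be induced.\<close>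
  define \<chi> where "\<chi> e = (if \<exists>y\<in>{1..R}. joined e y then SOME y. y \<in> {1..R} \<and> joined e y else 1)" for e
  have \<chi>: "\<chi> \<in> nsets {1..p} 2 \<rightarrow> {1..R}"
  proof
    fix e show "\<chi> e \<in> {1..R}"
    proof (cases "\<exists>y\<in>{1..R}. joined e y")
      case True
      then have "\<exists>y. y \<in> {1..R} \<and> joined e y" by blast
      from someI_ex[OF this] True show ?thesis unfolding \<chi>_def by presburger
    qed (simp add: \<chi>_def R_def)
  qed
  \<comment> \<open>Here the hypothesis on \<open>H\<close> enters: the row picked by
    \<open>SOME\<close> and \<open>y\<close> both carry a horizontal edge between \<open>x\<close>
    and \<open>x'\<close>, so they coincide.\<close>
  have \<chi>_eq: "\<chi> {x, x'} = y" if "{(x, y), (x', y)} \<in> edges H" "x \<noteq> x'" "y \<in> {1..R}" for x x' y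
  proof -
    have "joined {x, x'} y" using that by (simp add: joined_def)
    then have ex: "\<exists>y. y \<in> {1..R} \<and> joined {x, x'} y" using that by blast
    then have "\<chi> {x, x'} = (SOME y. y \<in> {1..R} \<and> joined {x, x'} y)"
      unfolding \<chi>_def by (intro if_P) blast
    then have "joined {x, x'} (\<chi> {x, x'})"
      using someI_ex[OF ex] by simp
    then have "horizontal_edge_between H {(x, \<chi> {x, x'}), (x', \<chi> {x, x'})} x x'"
      using that by (auto simp: horizontal_edge_between_def joined_def)
    moreover have "horizontal_edge_between H {(x, y), (x', y)} x x'"
      using that by (auto simp: horizontal_edge_between_def)
    ultimately have "{(x, \<chi> {x, x'}), (x', \<chi> {x, x'})} = {(x, y), (x', y)}"
      by (rule assms(3))
    then show ?thesis using \<open>x \<noteq> x'\<close> by (auto simp: doubleton_eq_iff)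
  qed
  have "2 \<le> p" by (simp add: p_def)
  \<comment> \<open>The colours will be subsets of \<open>{1..R}\<close>, hence the bound
    \<open>2 ^ R\<close>. Since \<open>R\<close>, \<open>p\<close> and \<open>\<chi>\<close> come
    from \<open>H\<close> alone, \<open>D\<close> depends neither on \<open>k\<close> nor on the
    host grid.\<close>
  obtain D where "\<forall>(V :: nat set) F g k. finite V \<longrightarrow> finite F \<longrightarrow> card F \<le> 2 ^ R \<longrightarrow>
       g \<in> nsets V 2 \<rightarrow> F \<longrightarrow> 2 \<le> k \<longrightarrow> k ^ D \<le> card V \<longrightarrow>
       (\<exists>f \<in> {1..p} \<rightarrow> V. inj_on f {1..p} \<and> (\<forall>e\<in>nsets {1..p} 2. \<chi> e \<in> g (f ` e))) \<or>
       (\<exists>i\<in>{1..R}. \<exists>S\<subseteq>V. k \<le> card S \<and> (\<forall>e\<in>nsets S 2. i \<notin> g e))"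
    using pattern_or_uncovered[OF assms(1) \<open>2 \<le> p\<close> \<chi>, where m = "2 ^ R" and 'a = nat] by auto
  note D = this[rule_format]
  have "grid_contains G H \<or> (\<exists>S. grid_coclique G k S)"
    if k: "2 \<le> k" and G: "spanning_grid_subgraph (k ^ (R * R + D)) G" for k G
  proof (rule ccontr)
    assume "\<not> ?thesis"
    then have not_contains: "\<not> grid_contains G H" and no_cc: "\<And>S. \<not> grid_coclique G k S" by auto
    define N where "N = k ^ (R * R + D)"
    have G': "cols G = N" "rows G = N" "verts G = {1..N} \<times> {1..N}"
      using G by (auto simp: spanning_grid_subgraph_def complete_grid_def N_def)
    have no_column: "\<not> pairwise (\<lambda>y y'. {(x, y), (x, y')} \<notin> edges G) S"
      if "x \<in> {1..N}" "S \<subseteq> {1..N}" "card S = k" for x S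
    proof
      assume "pairwise (\<lambda>y y'. {(x, y), (x, y')} \<notin> edges G) S"
      moreover have "finite S" using that by (auto intro: finite_subset)
      ultimately have "grid_coclique G k (Pair x ` S)"
        using that G' by (auto simp: grid_coclique_def card_image inj_on_def pairwise_image
            pairwise_def)
      then show False using no_cc by blast
    qed
    have no_row: "\<not> pairwise (\<lambda>x x'. {(x, y), (x', y)} \<notin> edges G) S"
      if "y \<in> {1..N}" "S \<subseteq> {1..N}" "card S = k" for y S
    proof
      assume "pairwise (\<lambda>x x'. {(x, y), (x', y)} \<notin> edges G) S"
      moreover have "finite S" using that by (auto intro: finite_subset)
      ultimately have "grid_coclique G k ((\<lambda>x. (x, y)) ` S)"
        using that G' by (auto simp: grid_coclique_def card_image inj_on_def pairwise_image
            pairwise_def)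
      then show False using no_cc by blast
    qed
    obtain K V where K: "K \<subseteq> {1..N}" "card K = R" and V: "V \<subseteq> {1..N}" "k ^ D \<le> card V"
      and clique: "\<And>x. x \<in> V \<Longrightarrow> pairwise (\<lambda>y y'. {(x, y), (x, y')} \<in> edges G) K"
      using many_columns_same_clique[of k R D N "edges G"] no_column k
      by (auto simp: R_def N_def)
    have "finite K" "finite V" using K V by (auto intro: finite_subset)
    then obtain h where h: "bij_betw h {1..R} K"
      using ex_bij_betw_nat_finite_1 K by blast
    \<comment> \<open>The colour of a pair of columns is the set of indices of those clique rows in
      which the two columns are adjacent.\<close>
    define g where "g e = {i \<in> {1..R}. (\<lambda>x. (x, h i)) ` e \<in> edges G}" for e
    have "g \<in> nsets V 2 \<rightarrow> Pow {1..R}" by (auto simp: g_def)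
    then consider
        f where "f \<in> {1..p} \<rightarrow> V" "inj_on f {1..p}" "\<And>e. e \<in> nsets {1..p} 2 \<Longrightarrow> \<chi> e \<in> g (f ` e)"
      | i S where "i \<in> {1..R}" "S \<subseteq> V" "k \<le> card S" "\<And>e. e \<in> nsets S 2 \<Longrightarrow> i \<notin> g e"
      using D[of V "Pow {1..R}" g k] \<open>finite V\<close> k V by (auto simp: card_Pow)
    then show False
    proof cases
      case (1 f)
      have sub: "{1..cols H} \<subseteq> {1..p}" "{1..rows H} \<subseteq> {1..R}" by (auto simp: p_def R_def)
      \<comment> \<open>Vertical edges of \<open>H\<close> map into the clique on \<open>K\<close>,
        which is present in every column of \<open>V\<close>; horizontal edges are supplied by the
        labels \<open>\<chi>\<close>.\<close>
      have "grid_embedding H G f h"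
        unfolding grid_embedding_def
      proof (intro conjI allI impI)
        show "f \<in> {1..cols H} \<rightarrow> {1..cols G}" using 1 sub V G' by auto
        show "inj_on f {1..cols H}" using 1 sub by (blast intro: inj_on_subset)
        show "h \<in> {1..rows H} \<rightarrow> {1..rows G}" using h sub K G' by (auto simp: bij_betw_def)
        show "inj_on h {1..rows H}" using h sub inj_on_subset unfolding bij_betw_def by blast
        fix x y x' y' assume e: "{(x, y), (x', y')} \<in> edges H"
        then have "(x, y) \<in> verts H" "(x', y') \<in> verts H" "(x, y) \<noteq> (x', y')" "x = x' \<or> y = y'"
          using assms(2) unfolding grid_subgraph_def
          by (fastforce simp: doubleton_eq_iff dest: bspec)+
        then have e': "x \<in> {1..p}" "x' \<in> {1..p}" "y \<in> {1..R}" "y' \<in> {1..R}"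
          and disj: "x = x' \<and> y \<noteq> y' \<or> x \<noteq> x' \<and> y = y'"
          using assms(2) sub by (auto simp: grid_subgraph_def)
        from disj show "{(f x, h y), (f x', h y')} \<in> edges G"
        proof
          assume "x = x' \<and> y \<noteq> y'"
          moreover from this have "h y \<noteq> h y'" "h y \<in> K" "h y' \<in> K"
            using h e' by (auto simp: bij_betw_def dest: inj_onD)
          moreover have "f x \<in> V" using 1 e' by blast
          ultimately show ?thesis using clique by (auto simp: pairwise_def)
        next
          assume *: "x \<noteq> x' \<and> y = y'"
          then have "{x, x'} \<in> nsets {1..p} 2" using e' by (auto simp: nsets_def)
          moreover have "\<chi> {x, x'} = y" using \<chi>_eq e e' * by blast
          ultimately have "y \<in> g {f x, f x'}" using 1(3)[of "{x, x'}"] by simp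
          then show ?thesis using * by (simp add: g_def)
        qed
      qed
      then show False using not_contains by (auto simp: grid_contains_def)
    next
      case (2 i S)
      \<comment> \<open>The missing label \<open>i\<close> means that row \<open>h i\<close> has no
        edge between columns of \<open>S\<close>, so any \<open>k\<close> of these columns give a
        coclique in that row.\<close>
      obtain T where T: "T \<subseteq> S" "card T = k" using 2 by (meson obtain_subset_with_card_n)
      have "pairwise (\<lambda>x x'. {(x, h i), (x', h i)} \<notin> edges G) T"
      proof (rule pairwiseI)
        fix x x' assume "x \<in> T" "x' \<in> T" "x \<noteq> x'"
        then have "{x, x'} \<in> nsets S 2" using T by (auto simp: nsets_def)
        then have "i \<notin> g {x, x'}" using 2 by blast
        then show "{(x, h i), (x', h i)} \<notin> edges G" using 2 by (simp add: g_def)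
      qed
      moreover have "h i \<in> {1..N}" using bij_betwE[OF h] K 2 by blast
      moreover have "T \<subseteq> {1..N}" using T 2 V by blast
      ultimately show False using no_row T by blast
    qed
  qed
  then have "gr H k \<le> enat (k ^ (R * R + D))" if "2 \<le> k" for k
    unfolding gr_def using that by (intro Inf_lower) auto
  then show ?thesis using assms(2) by (auto simp: PGR_def)
qed

end
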